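(* Let $\mathcal{P}$ be the set of polynomial filters and $\mathcal{T}$ the set of shift-invariant filters of $\mathbf{S}_1,\ldots,\mathbf{S}_d$, both regarded as unital semi-groups under matrix multiplication, and let $$C(\mathcal{T})=\{\mathbf{G}\in\mathcal{T}\ :\ \mathbf{H}\mathbf{G}=\mathbf{G}\mathbf{H}\ \text{for all}\ \mathbf{H}\in\mathcal{T}\}$$ be the center of $\mathcal{T}$. Then $C(\mathcal{T})=\mathcal{P}$.
   Context: Let $\mathcal{G}=(V,E,\mathbf{W})$ be a finite, simple, undirected graph with $N\ge 2$ vertices. A graph filter is a real matrix in $\mathbb{R}^{V\times V}$. A graph shift is a matrix $\mathbf{S}=[s(i,j)]_{i,j\in V}$ with $s(i,j)=0$ unless $i=j$ or $(i,j)\in E$. Standing assumption: $\mathbf{S}_1,\ldots,\mathbf{S}_d$ are graph shifts that are real-valued, symmetric and pairwise commuting. A polynomial filter is a matrix of the form $h(\mathbf{S}_1,\ldots,\mathbf{S}_d)$ for some real multivariate polynomial $h(t_1,\ldots,t_d)$. A shift-invariant filter is a graph filter $\mathbf{H}$ with $\mathbf{H}\mathbf{S}_l=\mathbf{S}_l\mathbf{H}$ for all $1\le l\le d$. *)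

theory Defs
  imports "HOL-Analysis.Analysis" "HOL-Library.Poly_Mapping" "HOL-Algebra.Group"
begin

text \<open>The vertex set is the (finite) type \<open>'v\<close>. An undirected edge is represented by both of its
  orientations. The weights are carried along as a component of the graph; no condition is imposed
  on them, since neither graph shifts nor filters depend on them.\<close>

record 'v wgraph =
  edges :: "('v \<times> 'v) set"
  weights :: "real^'v^'v"

definition simple_graph :: "'v::finite wgraph \<Rightarrow> bool" where
  "simple_graph G \<longleftrightarrow> sym (edges G) \<and> irrefl (edges G)"

definition graph_shift :: "'v::finite wgraph \<Rightarrow> real^'v^'v \<Rightarrow> bool" where
  "graph_shift G S \<longleftrightarrow> (\<forall>i j. \<not> (i = j \<or> (i, j) \<in> edges G) \<longrightarrow> S $ i $ j = 0)"

text \<open>The type class power \<open>A ^ k\<close> on \<open>real^'v^'v\<close> is taken entrywise, so powers with respect to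
  the matrix product \<open>**\<close> need their own definition.\<close>

primrec matrix_power :: "real^'v^'v \<Rightarrow> nat \<Rightarrow> real^'v^'v::finite" where
  "matrix_power A 0 = mat 1"
| "matrix_power A (Suc k) = A ** matrix_power A k"

text \<open>A monomial \<open>t\<^sub>1\<^bsup>m 1\<^esup> \<dots> t\<^sub>d\<^bsup>m d\<^esup>\<close> is its finitely supported exponent map
  \<open>m :: nat \<Rightarrow>\<^sub>0 nat\<close>, and a polynomial is a finitely supported map from monomials to coefficients.\<close>

type_synonym real_mpoly = "(nat \<Rightarrow>\<^sub>0 nat) \<Rightarrow>\<^sub>0 real"

definition polynomial_in :: "nat \<Rightarrow> real_mpoly \<Rightarrow> bool" where
  "polynomial_in d h \<longleftrightarrow> (\<forall>m \<in> Poly_Mapping.keys h. Poly_Mapping.keys m \<subseteq> {1..d})"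

text \<open>The factors are multiplied in the order \<open>S\<^sub>1\<^bsup>m 1\<^esup> ** \<dots> ** S\<^sub>d\<^bsup>m d\<^esup>\<close>; for commuting shifts
  the order is immaterial.\<close>

definition eval_monomial ::
    "nat \<Rightarrow> (nat \<Rightarrow> real^'v^'v) \<Rightarrow> (nat \<Rightarrow>\<^sub>0 nat) \<Rightarrow> real^'v^'v::finite" where
  "eval_monomial d S m =
     foldr (\<lambda>l M. matrix_power (S l) (Poly_Mapping.lookup m l) ** M) [1..<Suc d] (mat 1)"

definition eval_polynomial ::
    "nat \<Rightarrow> (nat \<Rightarrow> real^'v^'v) \<Rightarrow> real_mpoly \<Rightarrow> real^'v^'v::finite" where
  "eval_polynomial d S h =
     (\<Sum>m \<in> Poly_Mapping.keys h. Poly_Mapping.lookup h m *\<^sub>R eval_monomial d S m)"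

definition polynomial_filters :: "nat \<Rightarrow> (nat \<Rightarrow> real^'v^'v) \<Rightarrow> (real^'v^'v::finite) set" where
  "polynomial_filters d S = {eval_polynomial d S h | h. polynomial_in d h}"

definition shift_invariant_filters ::
    "nat \<Rightarrow> (nat \<Rightarrow> real^'v^'v) \<Rightarrow> (real^'v^'v::finite) set" where
  "shift_invariant_filters d S = {H. \<forall>l \<in> {1..d}. H ** S l = S l ** H}"

definition filter_monoid :: "(real^'v^'v::finite) set \<Rightarrow> (real^'v^'v) monoid" where
  "filter_monoid A = \<lparr>carrier = A, mult = (**), one = mat 1\<rparr>"

definition center :: "('a, 'b) monoid_scheme \<Rightarrow> 'a set" where
  "center M = {g \<in> carrier M. \<forall>h \<in> carrier M. h \<otimes>\<^bsub>M\<^esub> g = g \<otimes>\<^bsub>M\<^esub> h}"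

end

theory Submission
  imports Defs
begin

text \<open>The centre \<open>B\<close> of the commutant of the shifts is commutative and closed under transposition,
  hence has a separating vector \<open>x\<close>: if \<open>a \<in> B\<close> annihilates \<open>x\<close> but \<open>a \<noteq> 0\<close>, adding
  a suitable vector of the range of \<open>a\<^sup>T\<close> to \<open>x\<close> strictly shrinks the annihilator of \<open>x\<close>.
  The orthogonal projection onto \<open>P x\<close>, where \<open>P\<close> is the algebra of polynomial filters, commutes
  with the symmetric shifts, hence with every \<open>g \<in> B\<close>. So \<open>g x \<in> P x\<close>, say \<open>g x = a x\<close> with
  \<open>a \<in> P \<subseteq> B\<close>, and \<open>g = a\<close> because \<open>x\<close> is separating.\<close>

section \<open>Separating vectors, orthogonal projections and the double commutant\<close>

lemma matrix_add_rdistrib: "(A + B) ** C = A ** C + B ** (C :: 'a::semiring_1^'n^'m)"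
  by (vector matrix_matrix_mult_def sum.distrib[symmetric] distrib_right)

lemma transpose_add: "transpose (A + B) = transpose A + transpose B"
  by (simp add: transpose_def vec_eq_iff)

lemma inner_transpose_matrix_vector:
  "inner (transpose A *v x) y = inner x (A *v y)" for A :: "real^'n^'m"
  by (simp add: dot_lmul_matrix)

lemma subspace_commutant: "subspace {H :: real^'n^'n. H ** A = A ** H}"
  by (auto simp: subspace_def matrix_add_ldistrib matrix_add_rdistrib matrix_scalar_ac
      scalar_matrix_assoc[symmetric])

lemma separating_vector:
  fixes B :: "(real^'n^'n) set"
  assumes sub: "subspace B"
    and trans: "\<And>a. a \<in> B \<Longrightarrow> transpose a \<in> B"
    and comm: "\<And>a b. a \<in> B \<Longrightarrow> b \<in> B \<Longrightarrow> a ** b = b ** a"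
  shows "\<exists>x. \<forall>b\<in>B. b *v x = 0 \<longrightarrow> b = 0"
proof -
  define K where "K x = {b \<in> B. b *v x = 0}" for x
  have subK: "subspace (K x)" for x
    using sub by (auto simp: K_def subspace_def matrix_vector_mult_add_rdistrib
        scaleR_matrix_vector_assoc[symmetric])
  \<comment> \<open>Dimensions are natural numbers, so some \<open>x\<close> has an annihilator of
    least dimension; a strictly smaller one then gives a contradiction.\<close>
  obtain x where x: "\<And>y. dim (K x) \<le> dim (K y)"
    using ex_has_least_nat[of "\<lambda>_. True" undefined "\<lambda>x. dim (K x)"] by auto
  have "a = 0" if a: "a \<in> B" "a *v x = 0" for a
  proof (rule ccontr)
    assume "a \<noteq> 0"
    then have "transpose a \<noteq> 0"
      by (metis transpose_iff transpose_transpose transpose_scalar scaleR_zero_left)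
    then obtain y where y: "transpose a *v y \<noteq> 0"
      by (metis matrix_eq matrix_vector_mult_0)
    define z where "z = transpose a *v y"
    \<comment> \<open>Commuting \<open>b\<close> past \<open>transpose a\<close> and then past
      \<open>a\<close> turns the inner product of \<open>b *v z\<close> and \<open>b *v x\<close>
      into one with \<open>b *v (a *v x) = 0\<close>. Two orthogonal vectors with sum zero both
      vanish.\<close>
    have orth: "b *v x = 0 \<and> b *v z = 0" if b: "b \<in> B" "b *v (x + z) = 0" for b
    proof -
      have "inner (b *v z) (b *v x) = inner (transpose a *v (b *v y)) (b *v x)"
        by (metis a(1) b(1) comm trans z_def matrix_vector_mul_assoc)
      also have "\<dots> = inner (b *v y) (b *v (a *v x))"
        by (metis a(1) b(1) comm inner_transpose_matrix_vector matrix_vector_mul_assoc)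
      finally have "inner (b *v z) (b *v x) = 0"
        using a by simp
      moreover have "b *v x = - (b *v z)"
        using b by (simp add: matrix_vector_right_distrib eq_neg_iff_add_eq_0)
      ultimately show ?thesis
        by simp
    qed
    \<comment> \<open>Since \<open>z\<close> is nonzero, so is \<open>a *v z\<close>. Thus
      \<open>a\<close> annihilates \<open>x\<close> but not \<open>x + z\<close>, which makes the
      inclusion of annihilators strict.\<close>
    have "inner y (a *v z) = inner z z"
      by (metis inner_transpose_matrix_vector z_def)
    then have "a *v z \<noteq> 0"
      using y z_def by (metis inner_eq_zero_iff inner_zero_right)
    then have "K (x + z) \<subseteq> K x" "a \<in> K x" "a \<notin> K (x + z)"
      using orth a by (auto simp: K_def)
    then have "dim (K (x + z)) < dim (K x)"
      using dim_psubset[of "K (x + z)" "K x"] subK by (metis psubsetI span_eq_iff)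
    with x[of "x + z"] show False
      by simp
  qed
  then show ?thesis
    by blast
qed

text \<open>If \<open>a\<close> and its transpose both preserve \<open>U\<close>, then
  \<open>a\<close> preserves \<open>U\<close> and its orthogonal complement, so it respects the
  decomposition that defines the projection.\<close>

lemma orthogonal_projection_commutes:
  fixes U :: "(real^'n) set"
  assumes "subspace U"
  obtains p :: "real^'n^'n"
  where "\<And>v. p *v v \<in> U" "\<And>u. u \<in> U \<Longrightarrow> p *v u = u"
    "\<And>a. \<lbrakk>\<And>u. u \<in> U \<Longrightarrow> a *v u \<in> U; \<And>u. u \<in> U \<Longrightarrow> transpose a *v u \<in> U\<rbrakk> \<Longrightarrow> p ** a = a ** p"
proof -
  have "\<exists>y. y \<in> U \<and> (\<forall>u\<in>U. inner (v - y) u = 0)" for v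
    using orthogonal_subspace_decomp_exists[of U v] assms
    by (metis add_diff_cancel_left' orthogonal_def span_eq_iff)
  then obtain f where f: "\<And>v. f v \<in> U" "\<And>v u. u \<in> U \<Longrightarrow> inner (v - f v) u = 0"
    by metis
  \<comment> \<open>Any two candidates differ by a vector of \<open>U\<close> orthogonal to itself.
    Linearity, the fixed points and the commutation below all follow from this
    characterization.\<close>
  have uniq: "f v = y" if "y \<in> U" "\<And>u. u \<in> U \<Longrightarrow> inner (v - y) u = 0" for v y
  proof -
    have "f v - y \<in> U"
      using assms f(1) that(1) by (simp add: subspace_diff)
    then have "inner (f v - y) (f v - y) = 0"
      using f(2)[of "f v - y" v] that(2)[of "f v - y"] by (simp add: inner_diff_left)
    then show ?thesis
      by simp
  qed
  have "linear f"
  proof (rule linearI)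
    show "f (v + w) = f v + f w" for v w
      using assms f(1) f(2)[of _ v] f(2)[of _ w]
      by (intro uniq) (auto simp: subspace_add inner_diff_left inner_add_left)
    show "f (c *\<^sub>R v) = c *\<^sub>R f v" for c v
      using assms f(1) f(2)[of _ v]
      by (intro uniq) (auto simp: subspace_scale inner_diff_left)
  qed
  then have p: "matrix f *v v = f v" for v
    by (simp add: matrix_vector_mul)
  show thesis
  proof
    show "matrix f *v v \<in> U" for v
      using f p by simp
    show "matrix f *v u = u" if "u \<in> U" for u
      using that uniq[of u u] p by simp
    show "matrix f ** a = a ** matrix f"
      if "\<And>u. u \<in> U \<Longrightarrow> a *v u \<in> U" "\<And>u. u \<in> U \<Longrightarrow> transpose a *v u \<in> U" for a
    proof -
      have "f (a *v v) = a *v f v" for v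
      proof (rule uniq)
        show "a *v f v \<in> U"
          using f that by simp
        \<comment> \<open>Moving \<open>a\<close> across the inner product leaves
          \<open>v - f v\<close> against \<open>transpose a *v u\<close>, which lies in
          \<open>U\<close>.\<close>
        show "inner (a *v v - a *v f v) u = 0" if "u \<in> U" for u
          by (metis \<open>u \<in> U\<close> \<open>\<And>u. u \<in> U \<Longrightarrow> transpose a *v u \<in> U\<close> f(2) inner_commute
              inner_transpose_matrix_vector matrix_vector_mult_diff_distrib)
      qed
      then show ?thesis
        by (simp add: matrix_eq p flip: matrix_vector_mul_assoc)
    qed
  qed
qed

text \<open>A finite-dimensional double commutant theorem: \<open>bicomm\<close> places
  \<open>B\<close> in the bicommutant of \<open>A\<close>. Commutativity of \<open>B\<close>
  provides a separating vector, so agreement at this single vector determines an element of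
  \<open>B\<close>, and no passage to several copies of the space is made.\<close>

lemma bicommutant_subset:
  fixes A B :: "(real^'n^'n) set"
  assumes A: "subspace A" "mat 1 \<in> A" "\<And>a b. a \<in> A \<Longrightarrow> b \<in> A \<Longrightarrow> a ** b \<in> A"
      "\<And>a. a \<in> A \<Longrightarrow> transpose a \<in> A"
    and B: "subspace B" "\<And>a. a \<in> B \<Longrightarrow> transpose a \<in> B"
      "\<And>a b. a \<in> B \<Longrightarrow> b \<in> B \<Longrightarrow> a ** b = b ** a"
    and "A \<subseteq> B"
    and bicomm: "\<And>b h. b \<in> B \<Longrightarrow> (\<And>a. a \<in> A \<Longrightarrow> h ** a = a ** h) \<Longrightarrow> h ** b = b ** h"
  shows "B \<subseteq> A"
proof
  fix g assume g: "g \<in> B"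
  obtain x where x: "\<And>b. b \<in> B \<Longrightarrow> b *v x = 0 \<Longrightarrow> b = 0"
    using separating_vector[OF B] by blast
  define U where "U = (\<lambda>a. a *v x) ` A"
  have "linear (\<lambda>a::real^'n^'n. a *v x)"
    by (rule linearI) (simp_all add: matrix_vector_mult_add_rdistrib scaleR_matrix_vector_assoc)
  then have "subspace U"
    unfolding U_def using A(1) by (rule linear_subspace_image)
  then obtain p where p: "\<And>v. p *v v \<in> U" "\<And>u. u \<in> U \<Longrightarrow> p *v u = u"
    "\<And>a. \<lbrakk>\<And>u. u \<in> U \<Longrightarrow> a *v u \<in> U; \<And>u. u \<in> U \<Longrightarrow> transpose a *v u \<in> U\<rbrakk> \<Longrightarrow> p ** a = a ** p"
    by (rule orthogonal_projection_commutes) blast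
  have inv: "a *v u \<in> U" if "a \<in> A" "u \<in> U" for a u
    using that A(3) by (auto simp: U_def matrix_vector_mul_assoc)
  have "p ** a = a ** p" if "a \<in> A" for a
    using that by (intro p(3) inv A(4))
  then have "p ** g = g ** p"
    using bicomm g by blast
  \<comment> \<open>Hence \<open>p\<close> fixes \<open>x\<close>, and
    \<open>g *v x = g *v (p *v x) = p *v (g *v x)\<close> lies in the range of
    \<open>p\<close>.\<close>
  moreover have "x \<in> U"
    using A(2) by (auto simp: U_def image_iff intro: bexI[of _ "mat 1"])
  ultimately have "g *v x \<in> U"
    by (metis p(1,2) matrix_vector_mul_assoc)
  then obtain a where a: "a \<in> A" "g *v x = a *v x"
    by (auto simp: U_def)
  then have "g - a = 0"
    using g \<open>A \<subseteq> B\<close> B(1) by (intro x) (auto simp: subspace_diff matrix_vector_mult_diff_rdistrib)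
  with a show "g \<in> A"
    by simp
qed

section \<open>Powers and monomials of commuting matrices\<close>

lemma matrix_power_add: "matrix_power A (j + k) = matrix_power A j ** matrix_power A k"
  by (induction j) (simp_all add: matrix_mul_assoc)

lemma commute_matrix_mult:
  assumes "H ** A = A ** H" "H ** B = B ** H"
  shows "H ** (A ** B) = A ** B ** H"
proof -
  have "H ** (A ** B) = A ** (H ** B)"
    using assms(1) by (simp add: matrix_mul_assoc)
  then show ?thesis
    using assms(2) by (simp add: matrix_mul_assoc)
qed

lemma matrix_power_commute:
  assumes "H ** A = A ** H"
  shows "H ** matrix_power A k = matrix_power A k ** H"
  using assms by (induction k) (auto intro: commute_matrix_mult)

lemma matrix_powers_commute:
  assumes "A ** B = B ** A"
  shows "matrix_power A j ** matrix_power B k = matrix_power B k ** matrix_power A j"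
  by (intro matrix_power_commute matrix_power_commute[symmetric] assms[symmetric])

lemma foldr_matrix_commute:
  assumes "\<And>l. l \<in> set ls \<Longrightarrow> H ** f l = f l ** H"
  shows "H ** foldr (\<lambda>l. (**) (f l)) ls (mat 1) = foldr (\<lambda>l. (**) (f l)) ls (mat 1) ** H"
  using assms
  by (induction ls) (auto intro: commute_matrix_mult)

text \<open>Each \<open>g l\<close> is moved to the right past the product of the later factors
  \<open>f\<close>. With powers as factors, this is the addition of exponents in a product of
  monomials.\<close>

lemma foldr_matrix_mult:
  assumes "\<And>k l. k \<in> set ls \<Longrightarrow> l \<in> set ls \<Longrightarrow> g k ** f l = f l ** g k"
  shows "foldr (\<lambda>l. (**) (f l ** g l)) ls (mat 1) =
    foldr (\<lambda>l. (**) (f l)) ls (mat 1) ** foldr (\<lambda>l. (**) (g l)) ls (mat 1)"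
  using assms
proof (induction ls)
  case (Cons l ls)
  let ?F = "foldr (\<lambda>l. (**) (f l)) ls (mat 1)" and ?G = "foldr (\<lambda>l. (**) (g l)) ls (mat 1)"
  have "g l ** ?F = ?F ** g l"
    using Cons.prems by (intro foldr_matrix_commute) auto
  then have "f l ** (g l ** ?F) ** ?G = f l ** (?F ** g l) ** ?G"
    by simp
  then have "f l ** g l ** (?F ** ?G) = f l ** ?F ** (g l ** ?G)"
    by (simp only: matrix_mul_assoc)
  with Cons show ?case
    by simp
qed simp

lemma eval_monomial_commute:
  assumes "\<And>l. l \<in> {1..d} \<Longrightarrow> H ** S l = S l ** H"
  shows "H ** eval_monomial d S m = eval_monomial d S m ** H"
  unfolding eval_monomial_def
  using assms by (intro foldr_matrix_commute matrix_power_commute) auto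

lemma eval_monomial_zero: "eval_monomial d S 0 = mat 1"
proof -
  have "foldr (\<lambda>l. (**) (matrix_power (S l) (Poly_Mapping.lookup 0 l))) ls (mat 1) = mat 1" for ls
    by (induction ls) simp_all
  then show ?thesis
    by (simp only: eval_monomial_def)
qed

lemma eval_monomial_add:
  assumes "\<And>k l. k \<in> {1..d} \<Longrightarrow> l \<in> {1..d} \<Longrightarrow> S k ** S l = S l ** S k"
  shows "eval_monomial d S (m + n) = eval_monomial d S m ** eval_monomial d S n"
  unfolding eval_monomial_def lookup_add matrix_power_add
  using assms by (intro foldr_matrix_mult matrix_powers_commute) auto

lemma eval_monomial_single:
  assumes "l \<in> {1..d}"
  shows "eval_monomial d S (Poly_Mapping.single l 1) = S l"
proof -
  \<comment> \<open>Distinctness ensures that \<open>S l\<close> enters the product only once; all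
    other exponents are zero.\<close>
  have "foldr (\<lambda>k. (**) (matrix_power (S k) (Poly_Mapping.lookup (Poly_Mapping.single l 1) k))) ls (mat 1)
      = (if l \<in> set ls then S l else mat 1)" if "distinct ls" for ls
    using that by (induction ls) (auto simp: lookup_single when_def)
  then show ?thesis
    unfolding eval_monomial_def using assms by (auto simp del: upt_Suc)
qed

section \<open>The algebra of polynomial filters\<close>

text \<open>Monomials outside the keys have coefficient zero. This gives two polynomials and their
  sum a common index set, even when cancellation removes monomials from the sum.\<close>

lemma eval_polynomial_superset:
  assumes "finite M" "Poly_Mapping.keys h \<subseteq> M"
  shows "eval_polynomial d S h = (\<Sum>m\<in>M. Poly_Mapping.lookup h m *\<^sub>R eval_monomial d S m)"
  unfolding eval_polynomial_def
  using assms by (intro sum.mono_neutral_left) (auto simp: in_keys_iff)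

lemma subspace_polynomial_filters: "subspace (polynomial_filters d S)"
proof (rule subspaceI)
  have "eval_polynomial d S 0 = 0" "polynomial_in d 0"
    by (simp_all add: eval_polynomial_def polynomial_in_def)
  then show "0 \<in> polynomial_filters d S"
    unfolding polynomial_filters_def by force
next
  fix A B assume "A \<in> polynomial_filters d S" "B \<in> polynomial_filters d S"
  then obtain h k where h: "A = eval_polynomial d S h" "polynomial_in d h"
    and k: "B = eval_polynomial d S k" "polynomial_in d k"
    by (auto simp: polynomial_filters_def)
  let ?M = "Poly_Mapping.keys h \<union> Poly_Mapping.keys k"
  have "A + B = eval_polynomial d S (h + k)"
    unfolding h k using Poly_Mapping.keys_add[of h k]
    by (subst (1 2 3) eval_polynomial_superset[of ?M])
      (auto simp: lookup_add scaleR_add_left sum.distrib)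
  moreover have "polynomial_in d (h + k)"
    using h k Poly_Mapping.keys_add[of h k] unfolding polynomial_in_def by blast
  ultimately show "A + B \<in> polynomial_filters d S"
    unfolding polynomial_filters_def by blast
next
  fix c :: real and A assume "A \<in> polynomial_filters d S"
  then obtain h where h: "A = eval_polynomial d S h" "polynomial_in d h"
    by (auto simp: polynomial_filters_def)
  define k where "k = Poly_Mapping.map ((*) c) h"
  have lookup: "Poly_Mapping.lookup k m = c * Poly_Mapping.lookup h m" for m
    by (simp add: k_def Poly_Mapping.map.rep_eq when_def)
  \<comment> \<open>Only an inclusion holds in general, since \<open>c = 0\<close> removes every
    key.\<close>
  then have keys: "Poly_Mapping.keys k \<subseteq> Poly_Mapping.keys h"
    by (auto simp: in_keys_iff)
  have "c *\<^sub>R A = eval_polynomial d S k"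
    unfolding h using keys
    by (subst (1 2) eval_polynomial_superset[of "Poly_Mapping.keys h"])
      (auto simp: lookup scaleR_sum_right)
  moreover have "polynomial_in d k"
    using h keys unfolding polynomial_in_def by blast
  ultimately show "c *\<^sub>R A \<in> polynomial_filters d S"
    unfolding polynomial_filters_def by blast
qed

text \<open>With this description, a linear property of polynomial filters needs to be checked on
  monomials only, by \<open>span_minimal\<close>.\<close>

lemma polynomial_filters_eq_span:
  "polynomial_filters d S = span (eval_monomial d S ` {m. Poly_Mapping.keys m \<subseteq> {1..d}})"
    (is "_ = span ?E")
proof
  show "polynomial_filters d S \<subseteq> span ?E"
    by (auto simp: polynomial_filters_def polynomial_in_def eval_polynomial_def
        intro!: span_sum span_scale intro: span_base)
  have "?E \<subseteq> polynomial_filters d S"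
  proof safe
    fix m :: "nat \<Rightarrow>\<^sub>0 nat" assume "Poly_Mapping.keys m \<subseteq> {1..d}"
    then have "polynomial_in d (Poly_Mapping.single m 1)"
      by (simp add: polynomial_in_def)
    moreover have "eval_polynomial d S (Poly_Mapping.single m 1) = eval_monomial d S m"
      by (simp add: eval_polynomial_def)
    ultimately show "eval_monomial d S m \<in> polynomial_filters d S"
      unfolding polynomial_filters_def by force
  qed
  then show "span ?E \<subseteq> polynomial_filters d S"
    by (simp add: span_minimal subspace_polynomial_filters)
qed

lemma polynomial_filter_commute:
  assumes "A \<in> polynomial_filters d S" "\<And>l. l \<in> {1..d} \<Longrightarrow> H ** S l = S l ** H"
  shows "H ** A = A ** H"
proof -
  have "eval_monomial d S m ** H = H ** eval_monomial d S m" for m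
    using assms(2) by (rule eval_monomial_commute[symmetric])
  then have "polynomial_filters d S \<subseteq> {A. A ** H = H ** A}"
    unfolding polynomial_filters_eq_span
    by (intro span_minimal subspace_commutant) auto
  with assms show ?thesis
    by auto
qed

lemma mat_1_in_polynomial_filters: "mat 1 \<in> polynomial_filters d S"
  unfolding polynomial_filters_eq_span
  by (rule span_base, rule image_eqI[of _ _ 0]) (simp_all add: eval_monomial_zero)

lemma shift_in_polynomial_filters: "l \<in> {1..d} \<Longrightarrow> S l \<in> polynomial_filters d S"
  unfolding polynomial_filters_eq_span
  by (rule span_base, rule image_eqI[of _ _ "Poly_Mapping.single l 1"])
    (simp_all add: eval_monomial_single del: One_nat_def)

lemma polynomial_filters_mult:
  assumes "\<And>k l. k \<in> {1..d} \<Longrightarrow> l \<in> {1..d} \<Longrightarrow> S k ** S l = S l ** S k"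
    and "A \<in> polynomial_filters d S" "B \<in> polynomial_filters d S"
  shows "A ** B \<in> polynomial_filters d S"
proof -
  let ?P = "polynomial_filters d S"
  let ?E = "eval_monomial d S ` {m. Poly_Mapping.keys m \<subseteq> {1..d}}"
  have E: "a ** b \<in> ?P" if "a \<in> ?E" "b \<in> ?E" for a b
  proof -
    obtain m n where m: "a = eval_monomial d S m" "Poly_Mapping.keys m \<subseteq> {1..d}"
      and n: "b = eval_monomial d S n" "Poly_Mapping.keys n \<subseteq> {1..d}"
      using \<open>a \<in> ?E\<close> \<open>b \<in> ?E\<close> by blast
    have "a ** b = eval_monomial d S (m + n)"
      unfolding m n by (rule eval_monomial_add[OF assms(1), symmetric])
    moreover have "Poly_Mapping.keys (m + n) \<subseteq> {1..d}"
      using m(2) n(2) Poly_Mapping.keys_add[of m n] by (meson Un_least order_trans)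
    ultimately show ?thesis
      unfolding polynomial_filters_eq_span by (simp add: span_base)
  qed
  have P: "subspace ?P"
    by (rule subspace_polynomial_filters)
  \<comment> \<open>Bilinearity is used one factor at a time: first the right factor is extended
    from monomials to \<open>?P\<close> with a monomial on the left, then the left factor with
    \<open>B\<close> fixed.\<close>
  have "?P \<subseteq> {b. a ** b \<in> ?P}" if "a \<in> ?E" for a
    unfolding polynomial_filters_eq_span[of d S]
  proof (rule span_minimal)
    show "?E \<subseteq> {b. a ** b \<in> span ?E}"
      using E[OF that] unfolding polynomial_filters_eq_span by blast
    show "subspace {b. a ** b \<in> span ?E}"
      by (auto simp: subspace_def matrix_add_ldistrib matrix_scalar_ac scalar_matrix_assoc[symmetric]
          intro: span_add span_scale span_zero)
  qed
  then have "?E \<subseteq> {a. a ** B \<in> ?P}"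
    using assms(3) by blast
  moreover have "subspace {a. a ** B \<in> ?P}"
    using P by (auto simp: subspace_def matrix_add_rdistrib scalar_matrix_assoc[symmetric])
  ultimately have "?P \<subseteq> {a. a ** B \<in> ?P}"
    using span_minimal[of ?E] polynomial_filters_eq_span[of d S] by blast
  with assms(2) show ?thesis
    by blast
qed

text \<open>Transposition reverses the order of the symmetric factors, and commutativity restores
  it.\<close>

lemma transpose_eval_monomial:
  assumes "\<And>l. l \<in> {1..d} \<Longrightarrow> transpose (S l) = S l"
    and comm: "\<And>k l. k \<in> {1..d} \<Longrightarrow> l \<in> {1..d} \<Longrightarrow> S k ** S l = S l ** S k"
  shows "transpose (eval_monomial d S m) = eval_monomial d S m"
proof -
  have pow: "transpose (matrix_power (S l) k) = matrix_power (S l) k" if "l \<in> {1..d}" for l k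
    using that assms(1)[of l] matrix_power_commute[of "S l" "S l"]
    by (induction k) (simp_all add: matrix_transpose_mul)
  have "transpose (foldr (\<lambda>l. (**) (matrix_power (S l) (Poly_Mapping.lookup m l))) ls (mat 1)) =
      foldr (\<lambda>l. (**) (matrix_power (S l) (Poly_Mapping.lookup m l))) ls (mat 1)"
    if "set ls \<subseteq> {1..d}" for ls
    using that
  proof (induction ls)
    case (Cons l ls)
    have "matrix_power (S l) (Poly_Mapping.lookup m l) **
        foldr (\<lambda>l. (**) (matrix_power (S l) (Poly_Mapping.lookup m l))) ls (mat 1) =
        foldr (\<lambda>l. (**) (matrix_power (S l) (Poly_Mapping.lookup m l))) ls (mat 1) **
        matrix_power (S l) (Poly_Mapping.lookup m l)"
      using Cons.prems comm by (intro foldr_matrix_commute matrix_powers_commute) auto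
    with Cons pow[of l] show ?case
      by (simp add: matrix_transpose_mul)
  qed simp
  from this[of "[1..<Suc d]"] show ?thesis
    unfolding eval_monomial_def by (simp add: subset_eq del: upt_Suc)
qed

lemma transpose_polynomial_filter:
  assumes "\<And>l. l \<in> {1..d} \<Longrightarrow> transpose (S l) = S l"
    and "\<And>k l. k \<in> {1..d} \<Longrightarrow> l \<in> {1..d} \<Longrightarrow> S k ** S l = S l ** S k"
    and "A \<in> polynomial_filters d S"
  shows "transpose A = A"
proof -
  have "subspace {A :: real^'a^'a. transpose A = A}"
    by (auto simp: subspace_def transpose_add transpose_scalar) (simp add: transpose_def vec_eq_iff)
  then have "polynomial_filters d S \<subseteq> {A. transpose A = A}"
    unfolding polynomial_filters_eq_span
    using transpose_eval_monomial[OF assms(1,2)] by (intro span_minimal) auto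
  with assms(3) show ?thesis
    by blast
qed

section \<open>Shift-invariant filters and their center\<close>

lemma monoid_filter_monoid:
  assumes "mat 1 \<in> A" "\<And>a b. a \<in> A \<Longrightarrow> b \<in> A \<Longrightarrow> a ** b \<in> A"
  shows "monoid (filter_monoid A)"
  using assms by unfold_locales (auto simp: filter_monoid_def matrix_mul_assoc)

lemma shift_invariant_filters_mult:
  assumes "A \<in> shift_invariant_filters d S" "B \<in> shift_invariant_filters d S"
  shows "A ** B \<in> shift_invariant_filters d S"
  using assms commute_matrix_mult[of "S l" A B for l] by (simp add: shift_invariant_filters_def)

text \<open>Transposing the commutation relation of \<open>H\<close> with a symmetric shift gives
  that of \<open>transpose H\<close>.\<close>

lemma transpose_shift_invariant_filter:
  assumes "\<And>l. l \<in> {1..d} \<Longrightarrow> transpose (S l) = S l" "H \<in> shift_invariant_filters d S"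
  shows "transpose H \<in> shift_invariant_filters d S"
  unfolding shift_invariant_filters_def
proof safe
  fix l assume l: "l \<in> {1..d}"
  with assms(2) have "transpose (H ** S l) = transpose (S l ** H)"
    by (simp add: shift_invariant_filters_def)
  with assms(1)[OF l] show "transpose H ** S l = S l ** transpose H"
    by (simp add: matrix_transpose_mul)
qed

theorem theorem2p12:
  fixes G :: "'v::finite wgraph"
    and d :: nat
    and S :: "nat \<Rightarrow> real^'v^'v"
  assumes "CARD('v) \<ge> 2"
    and "simple_graph G"
    and "\<And>l. l \<in> {1..d} \<Longrightarrow> graph_shift G (S l)"
    and "\<And>l. l \<in> {1..d} \<Longrightarrow> transpose (S l) = S l"
    and "\<And>k l. k \<in> {1..d} \<Longrightarrow> l \<in> {1..d} \<Longrightarrow> S k ** S l = S l ** S k"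
  shows "monoid (filter_monoid (polynomial_filters d S)) \<and>
         monoid (filter_monoid (shift_invariant_filters d S)) \<and>
         center (filter_monoid (shift_invariant_filters d S)) = polynomial_filters d S"
proof (intro conjI)
  let ?P = "polynomial_filters d S" and ?T = "shift_invariant_filters d S"
  let ?B = "center (filter_monoid ?T)"
  note sym = assms(4) and comm = assms(5)
  show "monoid (filter_monoid ?P)"
    using mat_1_in_polynomial_filters polynomial_filters_mult[OF comm] by (rule monoid_filter_monoid)
  show "monoid (filter_monoid ?T)"
    by (rule monoid_filter_monoid)
      (simp_all add: shift_invariant_filters_mult, simp add: shift_invariant_filters_def)
  have B: "?B = {g \<in> ?T. \<forall>h\<in>?T. h ** g = g ** h}"
    by (simp add: center_def filter_monoid_def)
  have "?P \<subseteq> ?B"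
  proof
    fix a assume a: "a \<in> ?P"
    have "h ** a = a ** h" if "h \<in> ?T" for h
      using polynomial_filter_commute[OF a, of h] that by (auto simp: shift_invariant_filters_def)
    \<comment> \<open>The shifts commute pairwise, so each \<open>S l\<close> may take the role of
      \<open>H\<close> in \<open>polynomial_filter_commute\<close>.\<close>
    moreover have "a \<in> ?T"
      using polynomial_filter_commute[OF a, of "S l" for l] comm
      by (auto simp: shift_invariant_filters_def)
    ultimately show "a \<in> ?B"
      unfolding B by blast
  qed
  moreover have "?B \<subseteq> ?P"
  proof (rule bicommutant_subset)
    show "subspace ?B"
      unfolding B by (auto simp: subspace_def shift_invariant_filters_def matrix_add_ldistrib
          matrix_add_rdistrib matrix_scalar_ac scalar_matrix_assoc[symmetric])
    show "transpose a \<in> ?B" if "a \<in> ?B" for a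
    proof -
      \<comment> \<open>\<open>?T\<close> is closed under transposition, so \<open>a\<close>
        commutes with \<open>transpose h\<close>; transposing that relation gives the claim.\<close>
      have "h ** transpose a = transpose a ** h" if "h \<in> ?T" for h
      proof -
        have "transpose h \<in> ?T"
          using sym that by (rule transpose_shift_invariant_filter)
        with \<open>a \<in> ?B\<close> have "transpose h ** a = a ** transpose h"
          unfolding B by blast
        then show ?thesis
          by (metis matrix_transpose_mul transpose_transpose)
      qed
      with that sym show ?thesis
        unfolding B by (blast intro: transpose_shift_invariant_filter)
    qed
    show "a ** b = b ** a" if "a \<in> ?B" "b \<in> ?B" for a b
      using that unfolding B by blast
    show "h ** b = b ** h" if "b \<in> ?B" "\<And>a. a \<in> ?P \<Longrightarrow> h ** a = a ** h" for b h
    proof -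
      \<comment> \<open>The shifts are themselves polynomial filters, so the commutant of
        \<open>?P\<close> lies in \<open>?T\<close>, with which the center commutes.\<close>
      have "h \<in> ?T"
        using that(2) shift_in_polynomial_filters unfolding shift_invariant_filters_def by blast
      with that(1) show ?thesis
        unfolding B by blast
    qed
    show "transpose a \<in> ?P" if "a \<in> ?P" for a
      using transpose_polynomial_filter[OF sym comm that] that by simp
  qed (use \<open>?P \<subseteq> ?B\<close> in \<open>auto intro: subspace_polynomial_filters mat_1_in_polynomial_filters
      polynomial_filters_mult[OF comm]\<close>)
  ultimately show "?B = ?P"
    by blast
qed

end
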